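(* Let $\alpha\in(0,1)\setminus\mathbb{Q}$ and let $p_s/q_s$, $s\geq 0$, be the convergents to $\alpha$ given by its continued fraction expansion. If $n\geq 1$ is an integer with $q_s\leq n<q_{s+1}$, then $$\max\left\{\frac{n^2\log n}{2}-n^2,\ \left[\frac{n}{q_s}\right]\log q_{s+1}-n\right\}\leq e_n(\alpha)\leq \frac{n^2\log n}{2}+9n^2+\frac{n}{q_s}\log q_{s+1},$$ where $[x]$ denotes the greatest integer $\leq x$.
   Context: Let $\Delta$ be the closed unit disk in $\mathbb{C}$ and $\Delta^2$ the closed unit bidisk in $\mathbb{C}^2$. Let $\mathcal{P}_n$ be the space of polynomials $P\in\mathbb{C}[z,w]$ of total degree at most $n$. For $\alpha\in(0,1)\setminus\mathbb{Q}$ let $K=\{(e^z,e^{\alpha z}):\ |z|\leq 1\}\subset\mathbb{C}^2$, and for a set $A$ let $\|P\|_A=\sup_A|P|$. Define $E_n(\alpha)=\sup\{\|P\|_{\Delta^2}:\ P\in\mathcal{P}_n,\ \|P\|_K\leq 1\}$ (finite) and $e_n(\alpha)=\log E_n(\alpha)$. Continued fractions: $\alpha=[a_0;a_1,a_2,\dots]$ with integers $a_j$, $a_j\geq1$ for $j\geq1$; the convergents $p_s/q_s=[a_0;a_1,\dots,a_s]$ satisfy $p_s=a_sp_{s-1}+p_{s-2}$, $q_s=a_sq_{s-1}+q_{s-2}$ for $s\geq1$, with $p_0=a_0$, $q_0=1$, $p_{-1}=1$, $q_{-1}=0$. *)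

theory Defs
  imports "HOL-Analysis.Analysis"
begin

definition poly2 :: "nat \<Rightarrow> (nat \<Rightarrow> nat \<Rightarrow> complex) \<Rightarrow> complex \<Rightarrow> complex \<Rightarrow> complex" where
  "poly2 n c z w = (\<Sum>(i,j)\<in>{(i,j). i + j \<le> n}. c i j * z ^ i * w ^ j)"

definition bidisk :: "(complex \<times> complex) set" where
  "bidisk = {(z,w). cmod z \<le> 1 \<and> cmod w \<le> 1}"

definition Kset :: "real \<Rightarrow> (complex \<times> complex) set" where
  "Kset \<alpha> = {(exp z, exp (complex_of_real \<alpha> * z)) | z. cmod z \<le> 1}"

definition supnorm :: "nat \<Rightarrow> (nat \<Rightarrow> nat \<Rightarrow> complex) \<Rightarrow> (complex \<times> complex) set \<Rightarrow> real" where
  "supnorm n c A = (SUP p\<in>A. cmod (poly2 n c (fst p) (snd p)))"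

definition E_n :: "real \<Rightarrow> nat \<Rightarrow> real" where
  "E_n \<alpha> n = Sup {supnorm n c bidisk | c. supnorm n c (Kset \<alpha>) \<le> 1}"

definition e_n :: "real \<Rightarrow> nat \<Rightarrow> real" where
  "e_n \<alpha> n = ln (E_n \<alpha> n)"

text \<open>Continued fraction expansion: complete quotients, partial quotients a_k,
  and denominators of convergents.  \<open>cf_den \<alpha> s\<close> is \<open>q_s\<close>; it is computed via
  the shifted sequence \<open>qq\<close> with \<open>qq 0 = q_{-1} = 0\<close>, \<open>qq 1 = q_0 = 1\<close>.\<close>
fun cf_rem :: "real \<Rightarrow> nat \<Rightarrow> real" where
  "cf_rem x 0 = x"
| "cf_rem x (Suc k) = 1 / frac (cf_rem x k)"

definition cf_a :: "real \<Rightarrow> nat \<Rightarrow> int" where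
  "cf_a x k = \<lfloor>cf_rem x k\<rfloor>"

fun cf_qq :: "real \<Rightarrow> nat \<Rightarrow> int" where
  "cf_qq x 0 = 0"
| "cf_qq x (Suc 0) = 1"
| "cf_qq x (Suc (Suc k)) = cf_a x (Suc k) * cf_qq x (Suc k) + cf_qq x k"

definition cf_den :: "real \<Rightarrow> nat \<Rightarrow> int" where
  "cf_den x s = cf_qq x (Suc s)"

end

(*
  On the curve, P becomes the exponential sum f(z) = sum c_ij exp ((i + j alpha) z).

  Upper bound: applying the product of the operators d/dz - lambda over all exponents lambda but
  one isolates a single coefficient.  Each operator is controlled by Cauchy's estimate on a
  slightly smaller disc, so |c_a| prod |lambda_a - lambda_b| <= (M + n)^M with
  M + 1 = (n + 1)(n + 2)/2 the number of exponents.  The product is bounded below row by row: the row with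
  fixed j - m = d contributes a factorial times the distance of d alpha to the integers, which is
  at least 1/(4n) unless q_s divides d, and then it is at least 1/(2 q_{s+1}).

  Lower bounds: (z^p_s - w^q_s)^[n/q_s] is small on K and large at a point of the bidisk; and by
  counting dimensions some f vanishes at 0 to order M, hence is small on the unit disc.
*)
theory Submission
  imports Defs "HOL-Complex_Analysis.Complex_Analysis"
begin

subsection \<open>Rational approximation by convergents\<close>

text \<open>Indices are shifted as in \<open>cf_qq\<close>: \<open>cf_pp x k\<close> is \<open>p_{k-1}\<close> and \<open>cf_err x k\<close> is \<open>q_{k-1} x - p_{k-1}\<close>.\<close>
fun cf_pp :: "real \<Rightarrow> nat \<Rightarrow> int" where
  "cf_pp x 0 = 1"
| "cf_pp x (Suc 0) = cf_a x 0"
| "cf_pp x (Suc (Suc k)) = cf_a x (Suc k) * cf_pp x (Suc k) + cf_pp x k"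

definition cf_err :: "real \<Rightarrow> nat \<Rightarrow> real" where
  "cf_err x k = of_int (cf_qq x k) * x - of_int (cf_pp x k)"

section \<open>Complete quotients and signed errors of the convergents\<close>

lemma cf_rem_irrational:
  assumes "x \<notin> \<rat>"
  shows "cf_rem x k \<notin> \<rat>"
proof (induction k)
  case (Suc k)
  show ?case
  proof
    assume "cf_rem x (Suc k) \<in> \<rat>"
    then have "inverse (cf_rem x (Suc k)) \<in> \<rat>" by (rule Rats_inverse)
    then have "frac (cf_rem x k) + of_int \<lfloor>cf_rem x k\<rfloor> \<in> \<rat>"
      by (intro Rats_add) auto
    then show False using Suc by (simp add: frac_def)
  qed
qed (use assms in simp)

lemma frac_cf_rem:
  assumes "x \<notin> \<rat>"
  shows "0 < frac (cf_rem x k)" "frac (cf_rem x k) < 1"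
proof -
  have "cf_rem x k \<notin> \<int>" using cf_rem_irrational[OF assms] Ints_subset_Rats by blast
  then show "0 < frac (cf_rem x k)" by (simp add: frac_gt_0_iff)
qed (simp add: frac_lt_1)

lemma cf_a_pos:
  assumes "x \<notin> \<rat>"
  shows "1 \<le> cf_a x (Suc k)"
  using frac_cf_rem[OF assms, of k] by (simp add: cf_a_def le_floor_iff field_simps)

lemma cf_qq_pos:
  assumes "x \<notin> \<rat>"
  shows "0 \<le> cf_qq x k \<and> 1 \<le> cf_qq x (Suc k)"
proof (induction k)
  case (Suc k)
  have "1 * 1 \<le> cf_a x (Suc k) * cf_qq x (Suc k)"
    using cf_a_pos[OF assms, of k] Suc by (intro mult_mono) auto
  then show ?case using Suc by simp
qed simp

lemma cf_qq_mono:
  assumes "x \<notin> \<rat>"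
  shows "cf_qq x k \<le> cf_qq x (Suc k)"
proof (cases k)
  case (Suc m)
  have "1 * cf_qq x (Suc m) \<le> cf_a x (Suc m) * cf_qq x (Suc m)"
    using cf_a_pos[OF assms, of m] cf_qq_pos[OF assms, of m] by (intro mult_right_mono) auto
  then show ?thesis unfolding Suc cf_qq.simps using cf_qq_pos[OF assms, of m] by linarith
qed simp

text \<open>Each step of the common recursion flips the sign of the determinant, whose initial value
  in the shifted indexing is 1.\<close>

lemma cf_det: "cf_qq x (Suc k) * cf_pp x k - cf_qq x k * cf_pp x (Suc k) = (-1) ^ k"
  by (induction k) (auto simp: algebra_simps)

text \<open>The errors obey the recursion of the denominators. As \<open>cf_err x k\<close> is
  \<open>- cf_rem x (Suc k)\<close> times the next error, the new coefficient is a floor minus a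
  complete quotient, that is, minus a fractional part.\<close>

lemma cf_err_Suc:
  assumes "x \<notin> \<rat>"
  shows "cf_err x (Suc k) = - frac (cf_rem x k) * cf_err x k"
proof (induction k)
  case 0
  show ?case by (simp add: cf_err_def cf_a_def frac_def)
next
  case (Suc k)
  have f: "0 < frac (cf_rem x k)" using frac_cf_rem[OF assms] by blast
  have "cf_err x k = - cf_rem x (Suc k) * cf_err x (Suc k)"
    using Suc f by (simp add: field_simps)
  moreover have "cf_err x (Suc (Suc k)) = cf_a x (Suc k) * cf_err x (Suc k) + cf_err x k"
    by (simp add: cf_err_def algebra_simps)
  ultimately show ?case
    by (simp only: frac_def cf_a_def) (simp add: algebra_simps)
qed

lemma cf_err_sign:
  assumes "x \<notin> \<rat>"
  shows "0 < (-1) ^ Suc k * cf_err x k"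
proof (induction k)
  case (Suc k)
  then have "0 < frac (cf_rem x k) * ((-1) ^ Suc k * cf_err x k)"
    by (rule mult_pos_pos[OF frac_cf_rem(1)[OF assms]])
  then show ?case by (simp add: cf_err_Suc[OF assms] mult_ac)
qed (simp add: cf_err_def)

lemma abs_cf_err:
  assumes "x \<notin> \<rat>"
  shows "\<bar>cf_err x k\<bar> = (-1) ^ Suc k * cf_err x k"
proof -
  have "(-1) ^ Suc k = (1 :: real) \<or> (-1) ^ Suc k = (-1 :: real)"
    by (cases "even k") auto
  then show ?thesis using cf_err_sign[OF assms, of k] by (elim disjE) simp_all
qed

text \<open>Consecutive errors alternate in sign, so writing the absolute values as signed errors
  cancels the terms in \<open>x\<close> and leaves the determinant. Both bounds on a single error
  follow from this identity.\<close>

lemma cf_err_det: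
  assumes "x \<notin> \<rat>"
  shows "cf_qq x (Suc k) * \<bar>cf_err x k\<bar> + cf_qq x k * \<bar>cf_err x (Suc k)\<bar> = 1"
proof -
  have "cf_qq x (Suc k) * \<bar>cf_err x k\<bar> + cf_qq x k * \<bar>cf_err x (Suc k)\<bar>
      = (-1) ^ k * of_int (cf_qq x (Suc k) * cf_pp x k - cf_qq x k * cf_pp x (Suc k))"
    unfolding abs_cf_err[OF assms] unfolding cf_err_def by (simp add: algebra_simps)
  also have "\<dots> = 1" unfolding cf_det by (simp flip: power_mult_distrib)
  finally show ?thesis .
qed

lemma cf_err_le:
  assumes "x \<notin> \<rat>"
  shows "\<bar>cf_err x k\<bar> \<le> 1 / cf_qq x (Suc k)"
proof -
  have "1 \<le> cf_qq x (Suc k)" "0 \<le> cf_qq x k" using cf_qq_pos[OF assms, of k] by auto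
  moreover have "0 \<le> cf_qq x k * \<bar>cf_err x (Suc k)\<bar>" using calculation by simp
  then have "cf_qq x (Suc k) * \<bar>cf_err x k\<bar> \<le> 1" using cf_err_det[OF assms, of k] by linarith
  ultimately show ?thesis by (simp add: field_simps)
qed

text \<open>Errors shrink while denominators grow, so the second summand in
  \<open>cf_err_det\<close> is at most the first, which is therefore at least 1/2.\<close>

lemma cf_err_ge:
  assumes "x \<notin> \<rat>"
  shows "\<bar>cf_err x k\<bar> \<ge> 1 / (2 * cf_qq x (Suc k))"
proof -
  have q: "1 \<le> cf_qq x (Suc k)" "0 \<le> cf_qq x k" using cf_qq_pos[OF assms, of k] by auto
  have "\<bar>cf_err x (Suc k)\<bar> \<le> \<bar>cf_err x k\<bar>"
    using frac_cf_rem[OF assms, of k] mult_right_mono[of "frac (cf_rem x k)" 1 "\<bar>cf_err x k\<bar>"]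
    by (simp add: cf_err_Suc[OF assms] abs_mult)
  then have "cf_qq x k * \<bar>cf_err x (Suc k)\<bar> \<le> cf_qq x (Suc k) * \<bar>cf_err x k\<bar>"
    using q cf_qq_mono[OF assms, of k] by (intro mult_mono) auto
  then show ?thesis using cf_err_det[OF assms, of k] q by (simp add: field_simps)
qed

text \<open>Consecutive convergents form a unimodular basis, so \<open>(d, p)\<close> has integer
  coordinates \<open>u\<close>, \<open>v\<close>. The range of \<open>d\<close> forces
  \<open>u \<noteq> 0\<close>, and \<open>v\<close> to be zero or of sign opposite to
  \<open>u\<close>; as the two errors also have opposite signs, their contributions add up instead
  of cancelling.\<close>

lemma cf_best_approximation:
  fixes x :: real and d p :: int
  assumes x: "x \<notin> \<rat>" and d: "0 < d" "d < cf_qq x (Suc k)"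
  shows "\<bar>cf_err x k\<bar> \<le> \<bar>d * x - p\<bar>"
proof -
  \<comment> \<open>Cramer's rule; the determinant \<open>(-1) ^ k\<close> is its own
    inverse.\<close>
  define u where "u = (-1) ^ k * (cf_qq x (Suc k) * p - cf_pp x (Suc k) * d)"
  define v where "v = (-1) ^ k * (cf_pp x k * d - cf_qq x k * p)"
  define t where "t = frac (cf_rem x k)"
  have t: "0 < t" "t < 1" using frac_cf_rem[OF x] by (auto simp: t_def)
  have q: "1 \<le> cf_qq x (Suc k)" "0 \<le> cf_qq x k" using cf_qq_pos[OF x, of k] by auto
  have sq: "(-1) ^ k * (-1) ^ k = (1 :: int)" by (simp flip: power_mult_distrib)
  have "u * cf_qq x k + v * cf_qq x (Suc k) = (-1) ^ k * (d * (cf_qq x (Suc k) * cf_pp x k - cf_qq x k * cf_pp x (Suc k)))"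
    by (simp add: u_def v_def algebra_simps)
  then have dd: "d = u * cf_qq x k + v * cf_qq x (Suc k)"
    unfolding cf_det using sq by (simp add: mult.left_commute)
  have "u * cf_pp x k + v * cf_pp x (Suc k) = (-1) ^ k * (p * (cf_qq x (Suc k) * cf_pp x k - cf_qq x k * cf_pp x (Suc k)))"
    by (simp add: u_def v_def algebra_simps)
  then have pp: "p = u * cf_pp x k + v * cf_pp x (Suc k)"
    unfolding cf_det using sq by (simp add: mult.left_commute)
  have "d * x - p = u * cf_err x k + v * cf_err x (Suc k)"
    unfolding dd pp cf_err_def by (simp add: algebra_simps)
  also have "\<dots> = (u - v * t) * cf_err x k"
    by (simp add: cf_err_Suc[OF x] t_def algebra_simps)
  finally have eq: "\<bar>d * x - p\<bar> = \<bar>u - v * t\<bar> * \<bar>cf_err x k\<bar>" by (simp add: abs_mult)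
  have "1 \<le> \<bar>u - v * t\<bar>"
  proof (cases v "0 :: int" rule: linorder_cases)
    case less
    then have "v * cf_qq x (Suc k) < 0" using q by (simp add: mult_neg_pos)
    then have "0 < u * cf_qq x k" using dd d by linarith
    then have "0 < u" using q by (simp add: zero_less_mult_iff)
    moreover have "v * t < 0" using less t by (simp add: mult_neg_pos)
    ultimately show ?thesis by linarith
  next
    case equal
    then have "u \<noteq> 0" using dd d by auto
    then show ?thesis using equal by simp
  next
    case greater
    then have "1 * cf_qq x (Suc k) \<le> v * cf_qq x (Suc k)" using q by (intro mult_right_mono) auto
    then have "u * cf_qq x k < 0" using dd d by linarith
    then have "u < 0" using q by (simp add: mult_less_0_iff)
    moreover have "v * t > 0" using greater t by simp
    ultimately show ?thesis by linarith
  qed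
  then show ?thesis using eq mult_right_mono[of 1 _ "\<bar>cf_err x k\<bar>"] by simp
qed

lemma cf_dist_ge_half_inverse:
  fixes x :: real and d p :: int
  assumes x: "x \<notin> \<rat>" and d: "0 < d" "d < cf_qq x (Suc k)"
  shows "1 / (2 * cf_qq x (Suc k)) \<le> \<bar>d * x - p\<bar>"
  using cf_best_approximation[OF assms, of p] cf_err_ge[OF x, of k] by linarith

text \<open>If \<open>2 * d\<close> exceeds the next denominator, that denominator is below
  \<open>2 * n\<close> and the general bound suffices. Otherwise, with \<open>q = cf_qq x k\<close>,
  \<open>d\<close> times the convergent is at distance at least \<open>1 / q\<close> from every
  integer, and exchanging the convergent for \<open>x\<close> moves it by at most
  \<open>1 / (2 * q)\<close>.\<close>

lemma cf_dist_ge_of_not_dvd: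
  fixes x :: real and d p :: int
  assumes x: "x \<notin> \<rat>" and d: "0 < d" "d \<le> (n :: int)" "n < cf_qq x (Suc k)"
    and n: "cf_qq x k \<le> n" and nd: "\<not> cf_qq x k dvd d"
  shows "1 / (4 * n) \<le> \<bar>d * x - p\<bar>"
proof (cases "2 * d \<le> cf_qq x (Suc k)")
  case False
  then have "1 / (4 * real_of_int n) \<le> 1 / (2 * cf_qq x (Suc k))"
    using d by (intro divide_left_mono) (auto intro!: mult_pos_pos)
  then show ?thesis using cf_dist_ge_half_inverse[OF x, of d k p] d by simp
next
  case True
  define q where "q = cf_qq x k"
  have q: "0 \<le> q" "1 \<le> cf_qq x (Suc k)" using cf_qq_pos[OF x, of k] by (auto simp: q_def)
  \<comment> \<open>Zero occurs only at the shifted index 0, where the next denominator 1 leaves no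
    room for \<open>d\<close>.\<close>
  moreover have "q \<noteq> 0"
  proof
    assume "q = 0"
    then have "k = 0" using cf_qq_pos[OF x, of "k - 1"] by (cases k) (auto simp: q_def)
    then show False using d by simp
  qed
  ultimately have q: "0 < q" "1 \<le> cf_qq x (Suc k)" by auto
  \<comment> \<open>By the determinant identity \<open>q\<close> is coprime to
    \<open>cf_pp x k\<close>, so equality would force \<open>q\<close> to divide
    \<open>d\<close>.\<close>
  have "d * cf_pp x k \<noteq> p * q"
  proof
    assume *: "d * cf_pp x k = p * q"
    have "d * (-1) ^ k = cf_qq x (Suc k) * (d * cf_pp x k) - q * (d * cf_pp x (Suc k))"
      unfolding cf_det[of x k, symmetric] q_def by (simp add: algebra_simps)
    then have "d * (-1) ^ k = q * (cf_qq x (Suc k) * p - d * cf_pp x (Suc k))"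
      unfolding * by (simp add: algebra_simps)
    then have "q dvd d * (-1) ^ k" by simp
    then show False using nd unfolding q_def by (cases "even k") auto
  qed
  then have "1 \<le> \<bar>d * cf_pp x k - p * q\<bar>" by linarith
  then have "1 \<le> \<bar>real_of_int (d * cf_pp x k - p * q)\<bar>" by linarith
  also have "real_of_int (d * cf_pp x k - p * q) = q * (d * x - p) - d * cf_err x k"
    by (simp add: cf_err_def q_def algebra_simps)
  also have "\<bar>\<dots>\<bar> \<le> q * \<bar>d * x - p\<bar> + d * \<bar>cf_err x k\<bar>"
    using q d abs_triangle_ineq4[of "q * (d * x - p)" "d * cf_err x k"] by (simp add: abs_mult)
  also have "d * \<bar>cf_err x k\<bar> \<le> d * (1 / cf_qq x (Suc k))"
    using d cf_err_le[OF x, of k] by (intro mult_left_mono) auto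
  also have "d * (1 / cf_qq x (Suc k)) \<le> 1 / 2"
    using True q by (simp add: field_simps)
  finally have "1 / (2 * real_of_int q) \<le> \<bar>d * x - p\<bar>" using q by (simp add: field_simps)
  moreover have "1 / (4 * real_of_int n) \<le> 1 / (2 * real_of_int q)"
    using n q d by (intro divide_left_mono) (auto simp: q_def)
  ultimately show ?thesis by linarith
qed

text \<open>The two bounds are weakened to share the factor \<open>1 / (4 * n)\<close>, so that a
  product over many \<open>e\<close> only has to count multiples of the denominator. Negative
  \<open>e\<close> reduce to positive ones by changing the sign of \<open>p\<close>.\<close>

lemma cf_dist_ge:
  fixes x :: real and e p n :: int
  assumes x: "x \<notin> \<rat>" and e: "e \<noteq> 0" "\<bar>e\<bar> \<le> n" and n: "cf_qq x k \<le> n" "n < cf_qq x (Suc k)"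
  shows "1 / (4 * n) * (if cf_qq x k dvd e then 1 / cf_qq x (Suc k) else 1) \<le> \<bar>e * x - p\<bar>"
proof -
  have eq: "\<bar>e * x - p\<bar> = \<bar>\<bar>e\<bar> * x - (sgn e * p)\<bar>"
    by (cases e "0 :: int" rule: linorder_cases) (use e in auto)
  have Q: "1 \<le> cf_qq x (Suc k)" "1 \<le> n" using e n by linarith+
  show ?thesis
  proof (cases "cf_qq x k dvd e")
    case True
    have "1 / (4 * n) * (1 / real_of_int (cf_qq x (Suc k))) \<le> 1 / 2 * (1 / cf_qq x (Suc k))"
      using Q by (intro mult_right_mono) (auto simp: field_simps)
    then show ?thesis unfolding eq
      using cf_dist_ge_half_inverse[OF x, of "\<bar>e\<bar>" k "sgn e * p"] e n True by simp
  next
    case False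
    then show ?thesis unfolding eq
      using cf_dist_ge_of_not_dvd[OF x, of "\<bar>e\<bar>" n k "sgn e * p"] e n by simp
  qed
qed

subsection \<open>Exponential sums\<close>

lemma polyfun_coeff_bound:
  fixes a :: "nat \<Rightarrow> complex"
  assumes "\<And>z. cmod z \<le> 1 \<Longrightarrow> cmod (\<Sum>i\<le>n. a i * z ^ i) \<le> B" and "k \<le> n"
  shows "cmod (a k) \<le> B"
proof -
  let ?f = "\<lambda>z. \<Sum>i\<le>n. a i * z ^ i"
  have "?f has_fps_expansion (\<Sum>i\<le>n. fps_const (a i) * fps_X ^ i)"
    by (intro fps_expansion_intros)
  from fps_nth_fps_expansion[OF this, of k] have "a k = (deriv ^^ k) ?f 0 / fact k"
    using \<open>k \<le> n\<close> by (simp add: fps_sum_nth if_distrib sum.delta cong: if_cong)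
  then have "cmod (a k) = cmod ((deriv ^^ k) ?f 0) / fact k" by (simp add: norm_divide)
  moreover have "cmod ((deriv ^^ k) ?f 0) \<le> fact k * B / 1 ^ k"
    by (rule Cauchy_inequality) (auto intro!: holomorphic_intros continuous_intros assms(1))
  ultimately show ?thesis by (simp add: divide_le_eq mult.commute)
qed

text \<open>The sum with factors \<open>\<theta> b - \<mu>\<close> is \<open>g' - \<mu> * g\<close>
  for the original sum \<open>g\<close>, and Cauchy's estimate on the disc of radius
  \<open>\<delta>\<close> about \<open>z\<close> bounds \<open>g'\<close>.\<close>

lemma exp_sum_diff_op_bound:
  fixes c \<theta> :: "'a \<Rightarrow> complex" and r \<delta> :: real
  assumes bound: "\<And>z. cmod z \<le> r + \<delta> \<Longrightarrow> cmod (\<Sum>b\<in>A. c b * exp (\<theta> b * z)) \<le> C"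
    and "0 < \<delta>" and z: "cmod z \<le> r"
  shows "cmod (\<Sum>b\<in>A. c b * (\<theta> b - \<mu>) * exp (\<theta> b * z)) \<le> (1 / \<delta> + cmod \<mu>) * C"
proof -
  let ?g = "\<lambda>z. \<Sum>b\<in>A. c b * exp (\<theta> b * z)"
  have "(?g has_field_derivative (\<Sum>b\<in>A. c b * \<theta> b * exp (\<theta> b * z))) (at z)"
    by (auto intro!: derivative_eq_intros sum.cong)
  then have deriv: "deriv ?g z = (\<Sum>b\<in>A. c b * \<theta> b * exp (\<theta> b * z))"
    by (rule DERIV_imp_deriv)
  have "cmod ((deriv ^^ 1) ?g z) \<le> fact 1 * C / \<delta> ^ 1"
  proof (rule Cauchy_inequality)
    fix w assume "cmod (z - w) = \<delta>"
    then have "cmod w \<le> r + \<delta>"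
      using z norm_triangle_ineq4[of z "z - w"] by simp
    then show "cmod (?g w) \<le> C" by (rule bound)
  qed (use \<open>0 < \<delta>\<close> in \<open>auto intro!: holomorphic_intros continuous_intros\<close>)
  then have d: "cmod (deriv ?g z) \<le> 1 / \<delta> * C" by simp
  have "(\<Sum>b\<in>A. c b * (\<theta> b - \<mu>) * exp (\<theta> b * z)) = deriv ?g z - \<mu> * ?g z"
    unfolding deriv by (simp add: algebra_simps sum_subtractf sum_distrib_left)
  then have "cmod (\<Sum>b\<in>A. c b * (\<theta> b - \<mu>) * exp (\<theta> b * z)) \<le> cmod (deriv ?g z) + cmod \<mu> * cmod (?g z)"
    using norm_triangle_ineq4[of "deriv ?g z" "\<mu> * ?g z"] by (simp add: norm_mult)
  also have "\<dots> \<le> 1 / \<delta> * C + cmod \<mu> * C"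
    using d z \<open>0 < \<delta>\<close> by (intro add_mono mult_left_mono bound) auto
  finally show ?thesis by (simp add: algebra_simps)
qed

text \<open>Each operator costs \<open>\<delta>\<close> of the radius, so the induction keeps
  \<open>r\<close> arbitrary and uses its hypothesis on the disc of radius
  \<open>r + \<delta>\<close>.\<close>

lemma exp_sum_diff_ops_bound:
  fixes c \<theta> :: "'a \<Rightarrow> complex" and \<mu> :: "'b \<Rightarrow> complex" and r \<delta> :: real
  assumes "finite B" "0 < \<delta>" "\<And>b. b \<in> B \<Longrightarrow> cmod (\<mu> b) \<le> L"
    and "\<And>z. cmod z \<le> r + card B * \<delta> \<Longrightarrow> cmod (\<Sum>b\<in>A. c b * exp (\<theta> b * z)) \<le> C"
    and "cmod z \<le> r"
  shows "cmod (\<Sum>b\<in>A. c b * (\<Prod>x\<in>B. \<theta> b - \<mu> x) * exp (\<theta> b * z)) \<le> (1 / \<delta> + L) ^ card B * C"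
  using assms(1,3-)
proof (induction B arbitrary: r z rule: finite_induct)
  case (insert x B)
  have IH: "cmod (\<Sum>b\<in>A. c b * (\<Prod>x\<in>B. \<theta> b - \<mu> x) * exp (\<theta> b * w)) \<le> (1 / \<delta> + L) ^ card B * C"
    if w: "cmod w \<le> r + \<delta>" for w
  proof (rule insert.IH[OF _ _ w])
    fix v assume "cmod v \<le> r + \<delta> + card B * \<delta>"
    then show "cmod (\<Sum>b\<in>A. c b * exp (\<theta> b * v)) \<le> C"
      using insert.hyps by (intro insert.prems(2)) (simp add: algebra_simps)
  qed (use insert.prems in auto)
  have "cmod (\<Sum>b\<in>A. (c b * (\<Prod>x\<in>B. \<theta> b - \<mu> x)) * (\<theta> b - \<mu> x) * exp (\<theta> b * z))
      \<le> (1 / \<delta> + cmod (\<mu> x)) * ((1 / \<delta> + L) ^ card B * C)"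
    by (rule exp_sum_diff_op_bound[OF IH \<open>0 < \<delta>\<close> insert.prems(3)])
  also have "\<dots> \<le> (1 / \<delta> + L) * ((1 / \<delta> + L) ^ card B * C)"
  proof (rule mult_right_mono)
    have "0 \<le> L" using insert.prems(1)[of x] norm_ge_zero[of "\<mu> x"] by (auto intro: order_trans simp del: norm_ge_zero)
    moreover have "r + card (insert x B) * \<delta> \<ge> cmod z"
      using insert.prems(3) \<open>0 < \<delta>\<close> by (smt (verit) mult_nonneg_nonneg of_nat_0_le_iff)
    then have "0 \<le> C" using insert.prems(2)[of z] norm_ge_zero order_trans by blast
    ultimately show "0 \<le> (1 / \<delta> + L) ^ card B * C" using \<open>0 < \<delta>\<close> by simp
  qed (use insert.prems in auto)
  finally show ?case using insert.hyps by (simp add: mult_ac)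
qed auto

text \<open>The operators attached to the other exponents annihilate every term but that of
  \<open>a\<close>. With \<open>\<delta> = 1 / M\<close>, the \<open>M\<close> of them use up
  exactly the unit disc and leave the value at 0.\<close>

lemma exp_sum_coeff_bound:
  fixes c \<theta> :: "'a \<Rightarrow> complex"
  assumes A: "finite A" "a \<in> A" and M: "card A = Suc M" "0 < M"
    and L: "\<And>b. b \<in> A \<Longrightarrow> cmod (\<theta> b) \<le> L"
    and f: "\<And>z. cmod z \<le> 1 \<Longrightarrow> cmod (\<Sum>b\<in>A. c b * exp (\<theta> b * z)) \<le> 1"
  shows "cmod (c a) * (\<Prod>b\<in>A - {a}. cmod (\<theta> a - \<theta> b)) \<le> (M + L) ^ M"
proof -
  have card: "card (A - {a}) = M" using A M by simp
  have "cmod (\<Sum>b\<in>A. c b * (\<Prod>x\<in>A - {a}. \<theta> b - \<theta> x) * exp (\<theta> b * 0)) \<le> (1 / (1 / M) + L) ^ card (A - {a}) * 1"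
    by (rule exp_sum_diff_ops_bound[where r = 0]) (use A M L f card in auto)
  also have "(\<Sum>b\<in>A. c b * (\<Prod>x\<in>A - {a}. \<theta> b - \<theta> x) * exp (\<theta> b * 0)) = (\<Sum>b\<in>{a}. c b * (\<Prod>x\<in>A - {a}. \<theta> b - \<theta> x))"
    using A by (intro sum.mono_neutral_cong_right) auto
  finally show ?thesis unfolding card by (simp add: norm_mult prod_norm)
qed

text \<open>Induction on the number of equations: two solutions of the first \<open>m\<close>
  equations, told apart by their values at one index, are combined so that equation \<open>m\<close>
  holds too.\<close>

lemma homogeneous_system_nontrivial_solution:
  fixes g :: "nat \<Rightarrow> 'a \<Rightarrow> 'b :: field"
  assumes "finite A" "m < card A"
  shows "\<exists>c. (\<exists>x\<in>A. c x \<noteq> 0) \<and> (\<forall>k<m. (\<Sum>x\<in>A. c x * g k x) = 0)"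
  using assms
proof (induction m arbitrary: A)
  case 0
  then have "A \<noteq> {}" by auto
  then show ?case by (intro exI[of _ "\<lambda>_. 1"]) auto
next
  case (Suc m)
  have del: "\<exists>c. (\<exists>x\<in>A - {y}. c x \<noteq> 0) \<and> c y = 0 \<and> (\<forall>k<m. (\<Sum>x\<in>A. c x * g k x) = 0)" if "y \<in> A" for y
  proof -
    have "m < card (A - {y})" using Suc.prems that by simp
    then obtain c where c: "\<exists>x\<in>A - {y}. c x \<noteq> 0" "\<forall>k<m. (\<Sum>x\<in>A - {y}. c x * g k x) = 0"
      using Suc.IH[of "A - {y}"] Suc.prems by auto
    have "(\<Sum>x\<in>A. (c(y := 0)) x * g k x) = (\<Sum>x\<in>A - {y}. c x * g k x)" for k
      using Suc.prems by (intro sum.mono_neutral_cong_right) auto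
    then show ?thesis using c by (intro exI[of _ "c(y := 0)"]) auto
  qed
  have "A \<noteq> {}" using Suc.prems by auto
  then obtain y where "y \<in> A" by blast
  \<comment> \<open>\<open>c\<close> is nonzero at \<open>b\<close> while \<open>d\<close> vanishes
    there; this keeps \<open>t * c - s * d\<close> nonzero when \<open>t \<noteq> 0\<close>.\<close>
  from del[OF this] obtain c b where c: "b \<in> A" "c b \<noteq> 0" "\<forall>k<m. (\<Sum>x\<in>A. c x * g k x) = 0" by blast
  from del[OF c(1)] obtain d where d: "\<exists>x\<in>A. d x \<noteq> 0" "d b = 0" "\<forall>k<m. (\<Sum>x\<in>A. d x * g k x) = 0" by blast
  define s t where "s = (\<Sum>x\<in>A. c x * g m x)" and "t = (\<Sum>x\<in>A. d x * g m x)"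
  show ?case
  proof (cases "t = 0")
    case True
    then show ?thesis using d unfolding t_def by (intro exI[of _ d]) (auto simp: less_Suc_eq)
  next
    case False
    have "(\<Sum>x\<in>A. (t * c x - s * d x) * g k x) = t * (\<Sum>x\<in>A. c x * g k x) - s * (\<Sum>x\<in>A. d x * g k x)" for k
      by (simp add: algebra_simps sum_subtractf sum_distrib_left)
    then have "\<forall>k<Suc m. (\<Sum>x\<in>A. (t * c x - s * d x) * g k x) = 0"
      using c d by (auto simp: less_Suc_eq s_def t_def)
    moreover have "t * c b - s * d b \<noteq> 0" using False c d by simp
    ultimately show ?thesis using \<open>b \<in> A\<close> by (intro exI[of _ "\<lambda>x. t * c x - s * d x"]) blast
  qed
qed

text \<open>Up to factorials, the moments are the Taylor coefficients at 0. Those below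
  \<open>M\<close> vanish, and the others may be enlarged by \<open>R ^ k / R ^ M\<close>, which is
  at least 1; the sum is then dominated by the exponential series of \<open>L * R\<close>.\<close>

lemma exp_sum_vanishing_moments_bound:
  fixes c \<theta> :: "'a \<Rightarrow> complex"
  assumes "finite A" and moments: "\<And>k. k < M \<Longrightarrow> (\<Sum>b\<in>A. c b * \<theta> b ^ k) = 0"
    and L: "\<And>b. b \<in> A \<Longrightarrow> cmod (\<theta> b) \<le> L" and "0 \<le> L" and R: "1 \<le> R" and z: "cmod z \<le> 1"
  shows "cmod (\<Sum>b\<in>A. c b * exp (\<theta> b * z)) \<le> (\<Sum>b\<in>A. cmod (c b)) * exp (L * R) / R ^ M"
proof -
  define S where "S = (\<Sum>b\<in>A. cmod (c b))"
  have "(\<lambda>k. \<Sum>b\<in>A. c b * ((\<theta> b * z) ^ k /\<^sub>R fact k)) sums (\<Sum>b\<in>A. c b * exp (\<theta> b * z))"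
    by (intro sums_sum sums_mult exp_converges)
  also have "(\<lambda>k. \<Sum>b\<in>A. c b * ((\<theta> b * z) ^ k /\<^sub>R fact k)) = (\<lambda>k. (\<Sum>b\<in>A. c b * \<theta> b ^ k) * z ^ k /\<^sub>R fact k)"
    by (simp add: sum_distrib_left sum_distrib_right power_mult_distrib scaleR_conv_of_real mult_ac)
  finally have f: "(\<lambda>k. (\<Sum>b\<in>A. c b * \<theta> b ^ k) * z ^ k /\<^sub>R fact k) sums (\<Sum>b\<in>A. c b * exp (\<theta> b * z))" .
  have g: "(\<lambda>k. S / R ^ M * ((L * R) ^ k /\<^sub>R fact k)) sums (S / R ^ M * exp (L * R))"
    by (intro sums_mult exp_converges)
  have S: "0 \<le> S" by (simp add: S_def sum_nonneg)
  have term_le: "cmod ((\<Sum>b\<in>A. c b * \<theta> b ^ k) * z ^ k /\<^sub>R fact k) \<le> S / R ^ M * ((L * R) ^ k /\<^sub>R fact k)" for k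
  proof (cases "k < M")
    case True
    then show ?thesis using moments S R \<open>0 \<le> L\<close> by simp
  next
    case False
    have "cmod (\<Sum>b\<in>A. c b * \<theta> b ^ k) \<le> (\<Sum>b\<in>A. cmod (c b) * L ^ k)"
      by (rule order_trans[OF norm_sum], rule sum_mono)
        (auto simp: norm_mult norm_power intro!: mult_left_mono power_mono L)
    also have "\<dots> = S * L ^ k" by (simp add: S_def sum_distrib_right)
    also have "\<dots> \<le> S * L ^ k * (R ^ k / R ^ M)"
    proof -
      have "R ^ M \<le> R ^ k" using R False by (intro power_increasing) auto
      then have "1 \<le> R ^ k / R ^ M" using R by simp
      then show ?thesis using S \<open>0 \<le> L\<close> mult_left_mono[of 1 "R ^ k / R ^ M" "S * L ^ k"] by simp
    qed
    finally have "cmod (\<Sum>b\<in>A. c b * \<theta> b ^ k) * cmod z ^ k \<le> S * L ^ k * (R ^ k / R ^ M) * 1"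
      using z S \<open>0 \<le> L\<close> R by (intro mult_mono power_le_one) auto
    then have "cmod (\<Sum>b\<in>A. c b * \<theta> b ^ k) * cmod z ^ k / fact k \<le> S * L ^ k * (R ^ k / R ^ M) * 1 / fact k"
      by (intro divide_right_mono) auto
    then show ?thesis by (simp add: norm_mult norm_power power_mult_distrib divide_inverse mult_ac)
  qed
  have "cmod (\<Sum>k. (\<Sum>b\<in>A. c b * \<theta> b ^ k) * z ^ k /\<^sub>R fact k) \<le> (\<Sum>k. S / R ^ M * ((L * R) ^ k /\<^sub>R fact k))"
    by (rule norm_suminf_le[OF term_le sums_summable[OF g]])
  then show ?thesis using f g by (simp add: sums_iff S_def)
qed

text \<open>The farther endpoint of the interval is at distance at least half its length from the point;
  remove it and induct.\<close>
lemma prod_dist_ge: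
  fixes g :: "nat \<Rightarrow> real" and x :: real
  assumes "0 \<le> \<delta>" "\<And>l. l \<le> L \<Longrightarrow> \<delta> \<le> g l" "\<And>l. l \<le> L \<Longrightarrow> \<bar>x - l\<bar> \<le> g l"
  shows "\<delta> * fact L / 2 ^ L \<le> (\<Prod>l\<le>L. g l)"
  using assms(2,3)
proof (induction L arbitrary: g x)
  case (Suc L)
  have nonneg: "0 \<le> g l" if "l \<le> Suc L" for l
    using Suc.prems(1)[OF that] \<open>0 \<le> \<delta>\<close> by linarith
  have "\<bar>x - Suc L\<bar> \<ge> Suc L / 2 \<or> \<bar>x\<bar> \<ge> Suc L / 2" by (simp add: abs_if field_simps) linarith
  then show ?case
  proof
    assume "\<bar>x - Suc L\<bar> \<ge> Suc L / 2"
    then have "Suc L / 2 \<le> g (Suc L)" using Suc.prems(2)[of "Suc L"] by linarith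
    moreover have "\<delta> * fact L / 2 ^ L \<le> (\<Prod>l\<le>L. g l)" by (rule Suc.IH[where x = x]) (use Suc.prems in auto)
    ultimately have "(\<delta> * fact L / 2 ^ L) * (Suc L / 2) \<le> (\<Prod>l\<le>L. g l) * g (Suc L)"
      using nonneg \<open>0 \<le> \<delta>\<close> by (intro mult_mono) (auto intro!: prod_nonneg)
    then show ?thesis by (simp add: mult_ac)
  next
    assume "\<bar>x\<bar> \<ge> Suc L / 2"
    then have "Suc L / 2 \<le> g 0" using Suc.prems(2)[of 0] by simp
    moreover have "\<delta> * fact L / 2 ^ L \<le> (\<Prod>l\<le>L. g (Suc l))"
    proof (rule Suc.IH)
      show "\<bar>(x - 1) - real l\<bar> \<le> g (Suc l)" if "l \<le> L" for l
        using Suc.prems(2)[of "Suc l"] that by (simp add: algebra_simps)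
    qed (use Suc.prems in auto)
    ultimately have "(\<delta> * fact L / 2 ^ L) * (Suc L / 2) \<le> (\<Prod>l\<le>L. g (Suc l)) * g 0"
      using nonneg \<open>0 \<le> \<delta>\<close> by (intro mult_mono) (auto intro!: prod_nonneg)
    then show ?thesis unfolding prod.atMost_Suc_shift by (simp add: mult_ac)
  qed
qed simp

subsection \<open>Polynomials on the bidisk and on the curve\<close>

definition lattice_triangle :: "nat \<Rightarrow> (nat \<times> nat) set" where
  "lattice_triangle n = {(i, j). i + j \<le> n}"

definition expo :: "real \<Rightarrow> nat \<times> nat \<Rightarrow> complex" where
  "expo \<alpha> b = complex_of_real (real (fst b) + real (snd b) * \<alpha>)"

text \<open>The swap puts the exponent of \<open>w\<close> outside, which splits the triangle into
  rows along which \<open>expo\<close> changes by integers.\<close>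

lemma lattice_triangle_conv_Sigma: "lattice_triangle n = prod.swap ` (SIGMA j:{..n}. {..n - j})"
  by (auto simp: lattice_triangle_def image_iff)

lemma mem_lattice_triangle: "(i, j) \<in> lattice_triangle n \<longleftrightarrow> i + j \<le> n"
  by (simp add: lattice_triangle_def)

lemma finite_lattice_triangle [simp]: "finite (lattice_triangle n)"
  by (simp add: lattice_triangle_conv_Sigma)

lemma card_lattice_triangle: "2 * card (lattice_triangle n) = (n + 1) * (n + 2)"
proof -
  have "card (lattice_triangle n) = (\<Sum>j\<le>n. n - j + 1)"
    unfolding lattice_triangle_conv_Sigma by (subst card_image) auto
  also have "2 * \<dots> = (n + 1) * (n + 2)"
    by (induction n) (auto simp: sum.atMost_Suc_shift simp del: sum.atMost_Suc)
  finally show ?thesis .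
qed

lemma prod_lattice_triangle: "(\<Prod>b\<in>lattice_triangle n. f b) = (\<Prod>j\<le>n. \<Prod>i\<le>n - j. f (i, j))"
  unfolding lattice_triangle_conv_Sigma by (subst prod.reindex) (auto simp: prod.Sigma prod.swap_def case_prod_beta)

lemma poly2_eq: "poly2 n c z w = (\<Sum>b\<in>lattice_triangle n. c (fst b) (snd b) * z ^ fst b * w ^ snd b)"
  by (simp add: poly2_def lattice_triangle_def case_prod_beta)

lemma poly2_exp:
  "poly2 n c (exp z) (exp (complex_of_real \<alpha> * z)) = (\<Sum>b\<in>lattice_triangle n. c (fst b) (snd b) * exp (expo \<alpha> b * z))"
  unfolding poly2_eq expo_def
  by (intro sum.cong) (auto simp: algebra_simps exp_add simp flip: exp_of_nat_mult)

text \<open>Turns a sum of monomials into a coefficient array. Coefficients of coinciding monomials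
  are added, so exponent pairs may repeat.\<close>

lemma poly2_monomials:
  assumes "finite F" "\<And>k. k \<in> F \<Longrightarrow> u k + v k \<le> n"
  shows "poly2 n (\<lambda>i j. \<Sum>k\<in>F. if u k = i \<and> v k = j then a k else 0) z w = (\<Sum>k\<in>F. a k * z ^ u k * w ^ v k)"
proof -
  have "poly2 n (\<lambda>i j. \<Sum>k\<in>F. if u k = i \<and> v k = j then a k else 0) z w
      = (\<Sum>b\<in>lattice_triangle n. \<Sum>k\<in>F. if (u k, v k) = b then a k * z ^ u k * w ^ v k else 0)"
    unfolding poly2_eq by (auto simp: sum_distrib_right intro!: sum.cong)
  also have "\<dots> = (\<Sum>k\<in>F. \<Sum>b\<in>lattice_triangle n. if (u k, v k) = b then a k * z ^ u k * w ^ v k else 0)"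
    by (rule sum.swap)
  also have "\<dots> = (\<Sum>k\<in>F. a k * z ^ u k * w ^ v k)"
    using assms(2) by (intro sum.cong refl) (simp add: sum.delta mem_lattice_triangle)
  finally show ?thesis .
qed

lemma norm_poly2_bidisk_le:
  assumes "p \<in> bidisk"
  shows "cmod (poly2 n c (fst p) (snd p)) \<le> (\<Sum>b\<in>lattice_triangle n. cmod (c (fst b) (snd b)))"
  unfolding poly2_eq
proof (rule order_trans[OF norm_sum], rule sum_mono)
  fix b
  have "cmod (fst p) ^ fst b * cmod (snd p) ^ snd b \<le> 1 * 1"
    using assms by (intro mult_mono power_le_one) (auto simp: bidisk_def)
  then have "cmod (c (fst b) (snd b)) * (cmod (fst p) ^ fst b * cmod (snd p) ^ snd b) \<le> cmod (c (fst b) (snd b)) * 1"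
    by (intro mult_left_mono) auto
  then show "cmod (c (fst b) (snd b) * fst p ^ fst b * snd p ^ snd b) \<le> cmod (c (fst b) (snd b))"
    by (simp add: norm_mult norm_power mult.assoc)
qed

section \<open>Sup norms on the bidisk and on the curve\<close>

lemma bidisk_nonempty: "bidisk \<noteq> {}"
  by (auto simp: bidisk_def intro: exI[of _ 0])

lemma norm_poly2_le_supnorm_bidisk:
  assumes "cmod z \<le> 1" "cmod w \<le> 1"
  shows "cmod (poly2 n c z w) \<le> supnorm n c bidisk"
proof -
  have "cmod (poly2 n c (fst (z, w)) (snd (z, w))) \<le> supnorm n c bidisk"
    unfolding supnorm_def
  proof (rule cSUP_upper)
    show "bdd_above ((\<lambda>p. cmod (poly2 n c (fst p) (snd p))) ` bidisk)"
      by (intro bdd_aboveI2) (rule norm_poly2_bidisk_le)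
  qed (use assms in \<open>simp add: bidisk_def\<close>)
  then show ?thesis by simp
qed

text \<open>Cauchy's estimate is applied in \<open>z\<close> for each fixed \<open>w\<close>, and
  then to the resulting polynomial in \<open>w\<close>.\<close>

lemma coeff_le_supnorm_bidisk:
  assumes "(i, j) \<in> lattice_triangle n"
  shows "cmod (c i j) \<le> supnorm n c bidisk"
proof -
  have ij: "i \<le> n" "j \<le> n" "i + j \<le> n" using assms by (auto simp: lattice_triangle_def)
  \<comment> \<open>Extension by zero from the triangle to a square makes the sum an iterated
    one.\<close>
  define d where "d i j = (if i + j \<le> n then c i j else 0)" for i j
  have eq: "poly2 n c z w = (\<Sum>i\<le>n. (\<Sum>j\<le>n. d i j * w ^ j) * z ^ i)" for z w
  proof -
    have "poly2 n c z w = (\<Sum>b\<in>{..n} \<times> {..n}. d (fst b) (snd b) * z ^ fst b * w ^ snd b)"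
      unfolding poly2_eq
      by (intro sum.mono_neutral_cong_left) (auto simp: lattice_triangle_def d_def)
    also have "\<dots> = (\<Sum>i\<le>n. (\<Sum>j\<le>n. d i j * w ^ j) * z ^ i)"
      unfolding sum.cartesian_product' by (simp add: sum_distrib_left sum_distrib_right mult_ac)
    finally show ?thesis .
  qed
  have "cmod (d i j) \<le> supnorm n c bidisk"
  proof (rule polyfun_coeff_bound[OF _ ij(2)])
    fix w assume w: "cmod w \<le> 1"
    show "cmod (\<Sum>j\<le>n. d i j * w ^ j) \<le> supnorm n c bidisk"
    proof (rule polyfun_coeff_bound[OF _ ij(1)])
      fix z assume "cmod z \<le> 1"
      then show "cmod (\<Sum>i\<le>n. (\<Sum>j\<le>n. d i j * w ^ j) * z ^ i) \<le> supnorm n c bidisk"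
        using norm_poly2_le_supnorm_bidisk[OF _ w, of z n c] unfolding eq by blast
    qed
  qed
  then show ?thesis using ij by (simp add: d_def)
qed

lemma cmod_expo_le:
  assumes "0 < \<alpha>" "\<alpha> < 1" "b \<in> lattice_triangle n"
  shows "cmod (expo \<alpha> b) \<le> n"
proof -
  have "real (snd b) * \<alpha> \<le> real (snd b) * 1" using assms by (intro mult_left_mono) auto
  moreover have "real (fst b) + snd b \<le> n" using assms(3) by (auto simp: lattice_triangle_def simp flip: of_nat_add)
  ultimately show ?thesis using assms unfolding expo_def norm_of_real by simp
qed

lemma norm_poly2_le_supnorm_Kset:
  assumes \<alpha>: "0 < \<alpha>" "\<alpha> < 1" and z: "cmod z \<le> 1"
  shows "cmod (poly2 n c (exp z) (exp (complex_of_real \<alpha> * z))) \<le> supnorm n c (Kset \<alpha>)"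
proof -
  have bound: "cmod (poly2 n c (exp z) (exp (complex_of_real \<alpha> * z))) \<le> (\<Sum>b\<in>lattice_triangle n. cmod (c (fst b) (snd b)) * exp n)"
    if z: "cmod z \<le> 1" for z
    unfolding poly2_exp
  proof (rule order_trans[OF norm_sum], rule sum_mono)
    fix b assume b: "b \<in> lattice_triangle n"
    have "cmod (expo \<alpha> b * z) \<le> real n * 1"
      unfolding norm_mult using z by (intro mult_mono cmod_expo_le[OF \<alpha> b]) auto
    then have "cmod (exp (expo \<alpha> b * z)) \<le> exp n"
      by (intro order_trans[OF norm_exp]) simp
    then show "cmod (c (fst b) (snd b) * exp (expo \<alpha> b * z)) \<le> cmod (c (fst b) (snd b)) * exp n"
      unfolding norm_mult by (rule mult_left_mono) simp
  qed
  have "cmod (poly2 n c (fst (exp z, exp (complex_of_real \<alpha> * z))) (snd (exp z, exp (complex_of_real \<alpha> * z)))) \<le> supnorm n c (Kset \<alpha>)"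
    unfolding supnorm_def
  proof (rule cSUP_upper)
    show "bdd_above ((\<lambda>p. cmod (poly2 n c (fst p) (snd p))) ` Kset \<alpha>)"
      by (intro bdd_aboveI2[where M = "\<Sum>b\<in>lattice_triangle n. cmod (c (fst b) (snd b)) * exp n"])
        (auto simp: Kset_def intro!: bound)
  qed (use z in \<open>auto simp: Kset_def\<close>)
  then show ?thesis by simp
qed

text \<open>Dividing by \<open>B\<close> makes the polynomial admissible. Boundedness is a
  hypothesis because \<open>Sup\<close> of an unbounded set of reals carries no information; the
  coefficient bounds supply it later.\<close>

lemma E_n_ge:
  assumes bdd: "bdd_above {supnorm n c bidisk | c. supnorm n c (Kset \<alpha>) \<le> 1}" and "0 < B"
    and K: "\<And>z. cmod z \<le> 1 \<Longrightarrow> cmod (poly2 n c (exp z) (exp (complex_of_real \<alpha> * z))) \<le> B"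
    and A: "A \<le> supnorm n c bidisk"
  shows "A / B \<le> E_n \<alpha> n"
proof -
  define d where "d = (\<lambda>i j. c i j / B)"
  have d: "poly2 n d z w = poly2 n c z w / B" for z w
    unfolding poly2_eq d_def by (simp add: sum_divide_distrib)
  have "supnorm n d (Kset \<alpha>) \<le> 1"
    unfolding supnorm_def
  proof (rule cSUP_least)
    show "Kset \<alpha> \<noteq> {}" by (auto simp: Kset_def intro: exI[of _ 0])
  qed (use K \<open>0 < B\<close> in \<open>auto simp: Kset_def d norm_divide\<close>)
  then have "supnorm n d bidisk \<le> E_n \<alpha> n"
    unfolding E_n_def by (intro cSup_upper bdd) auto
  moreover have "supnorm n c bidisk \<le> B * supnorm n d bidisk"
    unfolding supnorm_def[of n c]
  proof (rule cSUP_least[OF bidisk_nonempty])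
    fix p assume "p \<in> bidisk"
    then have "cmod (poly2 n d (fst p) (snd p)) \<le> supnorm n d bidisk"
      by (intro norm_poly2_le_supnorm_bidisk) (auto simp: bidisk_def)
    then show "cmod (poly2 n c (fst p) (snd p)) \<le> B * supnorm n d bidisk"
      using \<open>0 < B\<close> by (simp add: d norm_divide field_simps)
  qed
  ultimately show ?thesis using A \<open>0 < B\<close> by (simp add: field_simps) (smt (verit) mult_left_mono)
qed

section \<open>Elementary estimates for factorials and residue classes\<close>

lemma power_div_fact_le_exp:
  fixes x :: real
  assumes "0 \<le> x"
  shows "x ^ k / fact k \<le> exp x"
proof -
  have "(\<Sum>i\<in>{k}. x ^ i /\<^sub>R fact i) \<le> (\<Sum>i. x ^ i /\<^sub>R fact i)"
    using assms by (intro sum_le_suminf summable_exp_generic) auto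
  then show ?thesis by (simp add: exp_def divide_inverse mult_ac)
qed

text \<open>Members of one residue class are told apart by \<open>j div q\<close>, which takes at
  most \<open>n div q + 1\<close> values, and \<open>j0\<close> itself is left out of the
  count.\<close>

lemma card_residue_class_less:
  fixes q j0 n :: nat
  assumes "0 < q" "j0 \<le> n"
  shows "card {j \<in> {..n} - {j0}. int q dvd (int j0 - int j)} \<le> n div q"
proof -
  let ?T = "{j \<in> {..n}. int q dvd (int j0 - int j)}"
  have "inj_on (\<lambda>j. j div q) ?T"
  proof (rule inj_onI)
    fix j k assume jk: "j \<in> ?T" "k \<in> ?T" "j div q = k div q"
    then have "int q dvd ((int j0 - int k) - (int j0 - int j))" using dvd_diff[of "int q" "int j0 - int k" "int j0 - int j"] by simp
    then have "int j mod int q = int k mod int q" by (simp add: mod_eq_dvd_iff)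
    then have "j mod q = k mod q" by (simp flip: of_nat_mod)
    then show "j = k" using jk(3) by (metis div_mult_mod_eq)
  qed
  moreover have "(\<lambda>j. j div q) ` ?T \<subseteq> {..n div q}" by (auto intro: div_le_mono)
  ultimately have "card ?T \<le> card {..n div q}" by (rule card_inj_on_le) simp
  moreover have "?T = insert j0 {j \<in> {..n} - {j0}. int q dvd (int j0 - int j)}" using assms by auto
  then have "card ?T = Suc (card {j \<in> {..n} - {j0}. int q dvd (int j0 - int j)})" by simp
  ultimately show ?thesis by simp
qed

subsection \<open>Products of differences of exponents\<close>

lemma sum_diff_atMost: "2 * (\<Sum>j\<le>n. n - j) = n * (n + 1 :: nat)"
  by (induction n) (auto simp: sum.atMost_Suc_shift simp del: sum.atMost_Suc)

text \<open>In each row \<open>prod_dist_ge\<close> separates one possibly small factor, at least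
  \<open>\<delta> j\<close>, from a factorial. The resulting bound does not depend on
  \<open>a\<close>.\<close>

lemma prod_expo_diff_ge:
  assumes \<alpha>: "\<alpha> \<notin> \<rat>" and n: "1 \<le> n" and q: "0 < q" "cf_qq \<alpha> k = int q" "q \<le> n"
    and Q: "cf_qq \<alpha> (Suc k) = int Q" "n < Q" and a: "a \<in> lattice_triangle n"
  shows "(1 / (4 * real n)) ^ n * (1 / real Q) ^ (n div q) * (exp (- real n) ^ (n + 1) * (real n / 2) ^ (\<Sum>j\<le>n. n - j))
    \<le> (\<Prod>b\<in>lattice_triangle n - {a}. cmod (expo \<alpha> a - expo \<alpha> b))"
proof -
  obtain i0 j0 where a_eq: "a = (i0, j0)" and ij: "j0 \<le> n" using a by (cases a) (auto simp: lattice_triangle_def)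
  \<comment> \<open>The value 1 at \<open>a\<close> itself lets the products run over whole
    rows.\<close>
  define g where "g = (\<lambda>j i. if (i, j) = a then 1 else cmod (expo \<alpha> a - expo \<alpha> (i, j)))"
  \<comment> \<open>In row \<open>j0\<close> the differences are nonzero integers away from
    \<open>a\<close>, hence the value 1; in the other rows \<open>cf_dist_ge\<close> applies with
    \<open>e = j0 - j\<close>.\<close>
  define \<delta> where "\<delta> = (\<lambda>j. if j = j0 then 1 else 1 / (4 * real n) * (if int q dvd (int j0 - int j) then 1 / real Q else 1))"
  have \<delta>_nonneg: "0 \<le> \<delta> j" for j by (auto simp: \<delta>_def)
  have g_eq: "g j i = (if (i, j) = a then 1 else \<bar>(real i0 + (int j0 - int j) * \<alpha>) - real i\<bar>)" for i j
  proof -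
    have "expo \<alpha> a - expo \<alpha> (i, j) = complex_of_real ((real i0 + (int j0 - int j) * \<alpha>) - real i)"
      by (simp add: expo_def a_eq algebra_simps)
    then show ?thesis unfolding g_def by (metis norm_of_real)
  qed
  have \<delta>_le: "\<delta> j \<le> g j i" if "j \<le> n" for i j
  proof (cases "j = j0")
    case True
    then show ?thesis unfolding g_eq \<delta>_def a_eq by auto
  next
    case False
    have "1 / (4 * int n) * (if cf_qq \<alpha> k dvd (int j0 - int j) then 1 / cf_qq \<alpha> (Suc k) else 1)
        \<le> \<bar>(int j0 - int j) * \<alpha> - (int i - int i0)\<bar>"
      by (rule cf_dist_ge[OF \<alpha>]) (use False that ij q Q in auto)
    then show ?thesis using False unfolding g_eq \<delta>_def a_eq q Q
      by (cases "int q dvd int j0 - int j") (simp_all add: algebra_simps)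
  qed
  \<comment> \<open>A single term of the exponential series bounds the factorial. Keeping the base
    \<open>n\<close> for all \<open>m\<close> makes every row contribute a power of the same
    number.\<close>
  have fact_ge: "exp (- real n) * (real n / 2) ^ m \<le> fact m / 2 ^ m" for m
    using power_div_fact_le_exp[of "real n" m] n
    by (simp add: exp_minus power_divide field_simps)
  have row: "\<delta> j * (exp (- real n) * (real n / 2) ^ (n - j)) \<le> (\<Prod>i\<le>n - j. g j i)" if "j \<le> n" for j
  proof -
    have "\<delta> j * (exp (- real n) * (real n / 2) ^ (n - j)) \<le> \<delta> j * (fact (n - j) / 2 ^ (n - j))"
      using \<delta>_nonneg by (intro mult_left_mono fact_ge) auto
    also have "\<dots> = \<delta> j * fact (n - j) / 2 ^ (n - j)" by simp
    also have "\<dots> \<le> (\<Prod>i\<le>n - j. g j i)"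
    proof (rule prod_dist_ge[OF \<delta>_nonneg \<delta>_le[OF that], where x = "real i0 + (int j0 - int j) * \<alpha>"])
      show "\<bar>(real i0 + (int j0 - int j) * \<alpha>) - real i\<bar> \<le> g j i" for i
        unfolding g_eq by (simp add: a_eq)
    qed
    finally show ?thesis .
  qed
  have "(1 / (4 * real n)) ^ n * (1 / real Q) ^ (n div q) \<le> (\<Prod>j\<le>n. \<delta> j)"
  proof -
    let ?T = "{j \<in> {..n} - {j0}. int q dvd (int j0 - int j)}"
    have "(\<Prod>j\<le>n. \<delta> j) = (\<Prod>j\<in>{..n} - {j0}. \<delta> j)"
      using ij by (subst prod.remove[of _ j0]) (auto simp: \<delta>_def)
    also have "\<dots> = (\<Prod>j\<in>{..n} - {j0}. 1 / (4 * real n) * (if int q dvd (int j0 - int j) then 1 / real Q else 1))"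
      by (intro prod.cong) (auto simp: \<delta>_def)
    also have "\<dots> = (1 / (4 * real n)) ^ n * (\<Prod>j\<in>{..n} - {j0}. if int q dvd (int j0 - int j) then 1 / real Q else 1)"
      using ij by (simp only: prod.distrib) simp
    also have "(\<Prod>j\<in>{..n} - {j0}. if int q dvd (int j0 - int j) then 1 / real Q else 1) = (1 / real Q) ^ card ?T"
      by (simp add: prod.inter_filter[symmetric] del: prod_constant) simp
    finally have eq: "(\<Prod>j\<le>n. \<delta> j) = (1 / (4 * real n)) ^ n * (1 / real Q) ^ card ?T" .
    \<comment> \<open>Since \<open>1 / Q \<le> 1\<close>, raising the exponent from
      \<open>card ?T\<close> to \<open>n div q\<close> only decreases the power.\<close>
    show ?thesis unfolding eq
      using card_residue_class_less[OF q(1) ij] Q by (intro mult_left_mono power_decreasing) auto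
  qed
  moreover have "(\<Prod>j\<le>n. exp (- real n) * (real n / 2) ^ (n - j)) = exp (- real n) ^ (n + 1) * (real n / 2) ^ (\<Sum>j\<le>n. n - j)"
    by (simp add: prod.distrib power_sum)
  ultimately have "(1 / (4 * real n)) ^ n * (1 / real Q) ^ (n div q) * (exp (- real n) ^ (n + 1) * (real n / 2) ^ (\<Sum>j\<le>n. n - j))
      \<le> (\<Prod>j\<le>n. \<delta> j) * (\<Prod>j\<le>n. exp (- real n) * (real n / 2) ^ (n - j))"
    by (simp only:) (rule mult_right_mono, auto)
  also have "\<dots> = (\<Prod>j\<le>n. \<delta> j * (exp (- real n) * (real n / 2) ^ (n - j)))"
    by (rule prod.distrib[symmetric])
  also have "\<dots> \<le> (\<Prod>j\<le>n. \<Prod>i\<le>n - j. g j i)"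
    using row \<delta>_nonneg by (intro prod_mono) auto
  also have "\<dots> = (\<Prod>b\<in>lattice_triangle n. if b = a then 1 else cmod (expo \<alpha> a - expo \<alpha> b))"
    unfolding prod_lattice_triangle g_def by simp
  also have "\<dots> = (\<Prod>b\<in>lattice_triangle n - {a}. cmod (expo \<alpha> a - expo \<alpha> b))"
    using a by (subst prod.remove[of _ a]) (auto intro!: prod.cong)
  finally show ?thesis .
qed

text \<open>\<open>N\<close> counts the coefficients and \<open>T\<close> is the total exponent of
  \<open>n / 2\<close>. With \<open>L = ln n\<close>, the main terms
  \<open>2 * M * L - T * L\<close> give \<open>n^2 * L / 2\<close> plus a multiple of
  \<open>n * L\<close>; apart from the term in \<open>Q\<close>, everything else fits into
  \<open>9 * n^2\<close> because \<open>L \<le> n - 1\<close>.\<close>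

lemma upper_exponent_le:
  fixes n N M T k q Q :: nat
  assumes n: "1 \<le> n" and N: "2 * N = (n + 1) * (n + 2)" "N = Suc M" and T: "2 * T = n * (n + 1)"
    and q: "0 < q" and Q: "n < Q"
  shows "ln (real N * ((real M + real n) ^ M / ((1 / (4 * real n)) ^ n * (1 / real Q) ^ (n div q) * (exp (- real n) ^ (n + 1) * (real n / 2) ^ T))))
    \<le> real n ^ 2 * ln (real n) / 2 + 9 * real n ^ 2 + real n / real q * ln (real Q)"
proof -
  define x L where "x = real n" and "L = ln x"
  have x: "1 \<le> x" using n by (simp add: x_def)
  have L: "0 \<le> L" "L \<le> x - 1" using x ln_le_minus_one[of x] by (auto simp: L_def)
  have "real (2 * N) = real ((n + 1) * (n + 2))" using N(1) by (rule arg_cong)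
  then have N_eq: "real N = (x + 1) * (x + 2) / 2" by (simp add: x_def field_simps)
  then have M_eq: "real M = (x\<^sup>2 + 3 * x) / 2" using N(2) by (simp add: power2_eq_square algebra_simps)
  have "real (2 * T) = real (n * (n + 1))" using T by (rule arg_cong)
  then have T_eq: "real T = (x\<^sup>2 + x) / 2" by (simp add: x_def power2_eq_square algebra_simps)
  have xx: "x \<le> x\<^sup>2" using x by (simp add: power2_eq_square)
  have ln2: "ln 2 \<le> (7 / 10 :: real)" using ln2_le_25_over_36 by simp
  have ln4: "ln 4 = 2 * ln (2 :: real)" using ln_realpow[of 2 2] by simp
  have "ln 3 \<le> ln (4 :: real)" by simp
  then have ln3: "ln 3 \<le> (14 / 10 :: real)" using ln4 ln2 by linarith
  have ln3x: "ln (3 * x\<^sup>2) = ln 3 + 2 * L"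
    using x by (simp add: L_def ln_mult ln_realpow)
  have "real N = (x\<^sup>2 + 3 * x + 2) / 2" unfolding N_eq by (simp add: power2_eq_square algebra_simps)
  then have "2 * real N = x\<^sup>2 + 3 * x + 2" by simp
  then have "real N \<le> 3 * x\<^sup>2" using x xx by (smt (verit))
  then have "ln (real N) \<le> ln (3 * x\<^sup>2)"
    using x N(2) by (subst ln_le_cancel_iff) auto
  then have lnN: "ln (real N) \<le> ln 3 + 2 * L" using ln3x by simp
  have Mpos: "0 < real M + x" using x by simp
  have "ln (real M + x) \<le> ln (3 * x\<^sup>2)"
    using x xx Mpos M_eq by (subst ln_le_cancel_iff) auto
  then have lnM: "real M * ln (real M + x) \<le> real M * (ln 3 + 2 * L)"
    unfolding ln3x by (intro mult_left_mono) auto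
  have M_ln3: "real M * ln 3 \<le> real M * (14 / 10)" using ln3 by (intro mult_left_mono) auto
  have T_ln2: "real T * ln 2 \<le> real T * (7 / 10)" using ln2 by (intro mult_left_mono) auto
  have x_ln4: "x * ln 4 \<le> x * (14 / 10)" using ln2 ln4 x by (intro mult_left_mono) auto
  have xL: "x * L \<le> x * (x - 1)" using x L by (intro mult_left_mono) auto
  have kQ: "real (n div q) * ln (real Q) \<le> x / real q * ln (real Q)"
  proof (rule mult_right_mono)
    show "real (n div q) \<le> x / real q" unfolding x_def by (rule of_nat_div_le_of_nat)
  qed (use Q in auto)
  have "ln (real N * ((real M + x) ^ M / ((1 / (4 * x)) ^ n * (1 / real Q) ^ (n div q) * (exp (- x) ^ (n + 1) * (x / 2) ^ T))))
      = ln (real N) + (real M * ln (real M + x) - (x * - (ln 4 + L) + real (n div q) * - ln (real Q) + ((x + 1) * - x + real T * (L - ln 2))))"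
    using x Mpos N Q by (simp add: ln_mult ln_div ln_realpow L_def) (simp add: x_def algebra_simps)
  also have "\<dots> \<le> x ^ 2 * L / 2 + 9 * x ^ 2 + x / real q * ln (real Q)"
  proof -
    have "ln (real N) + (real M * ln (real M + x) - (x * - (ln 4 + L) + real (n div q) * - ln (real Q) + ((x + 1) * - x + real T * (L - ln 2))))
       \<le> (ln 3 + 2 * L) + real M * (ln 3 + 2 * L) + x * (14 / 10) + x * L + x / real q * ln (real Q) + (x\<^sup>2 + x) - real T * L + real T * (7 / 10)"
      using lnN lnM kQ x_ln4 T_ln2 by (simp add: algebra_simps power2_eq_square)
    also have "\<dots> \<le> (14 / 10 + 2 * L) + (real M * (14 / 10) + real M * (2 * L)) + x * (14 / 10) + x * L + x / real q * ln (real Q) + (x\<^sup>2 + x) - real T * L + real T * (7 / 10)"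
      using ln3 M_ln3 by (simp add: algebra_simps)
    also have "\<dots> \<le> x\<^sup>2 * L / 2 + 9 * x\<^sup>2 + x / real q * ln (real Q)"
    proof -
      have "real M * (2 * L) - real T * L = x\<^sup>2 * L / 2 + 5 / 2 * (x * L)"
        unfolding M_eq T_eq by (simp add: field_simps)
      moreover have "x * L \<le> x\<^sup>2 - x" using xL by (simp add: power2_eq_square algebra_simps)
      moreover have "real M * (14 / 10) = 7 / 10 * x\<^sup>2 + 21 / 10 * x"
        unfolding M_eq by (simp add: field_simps)
      moreover have "real T * (7 / 10) = 7 / 20 * x\<^sup>2 + 7 / 20 * x"
        unfolding T_eq by (simp add: field_simps)
      ultimately show ?thesis using L xx x by argo
    qed
    finally show ?thesis .
  qed
  finally show ?thesis by (simp add: x_def L_def)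
qed

text \<open>The main term comes from \<open>M * ln (n / 2)\<close>. Its surplus
  \<open>3 / 2 * n * ln n\<close> is at least \<open>3 * n\<close> because
  \<open>ln n \<ge> 2\<close>, and pays for \<open>ln N\<close> and the linear part of
  \<open>M * ln 2\<close>; the quadratic losses stay below \<open>n^2\<close>.\<close>

lemma lower_exponent_ge:
  fixes n N M :: nat
  assumes ln: "2 \<le> ln (real n)" and n: "1 \<le> n" and N: "2 * N = (n + 1) * (n + 2)" "N = Suc M"
  shows "real n ^ 2 * ln (real n) / 2 - real n ^ 2 \<le> ln (1 / (real N * exp (real n * (real n / 2)) / (real n / 2) ^ M))"
proof -
  define x L where "x = real n" and "L = ln x"
  have x: "1 \<le> x" using n by (simp add: x_def)
  have "real (2 * N) = real ((n + 1) * (n + 2))" using N(1) by (rule arg_cong)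
  then have N_eq: "real N = (x + 1) * ((x + 2) / 2)" by (simp add: x_def field_simps)
  then have M_eq: "real M = (x\<^sup>2 + 3 * x) / 2" using N(2) by (simp add: power2_eq_square algebra_simps)
  have "ln (real N) \<le> x + x / 2"
    using x ln_le_minus_one[of "x + 1"] ln_le_minus_one[of "(x + 2) / 2"]
      ln_mult_pos[of "x + 1" "(x + 2) / 2"] unfolding N_eq by (simp add: field_simps)
  moreover have "ln (1 / (real N * exp (x * (x / 2)) / (x / 2) ^ M)) = real M * (L - ln 2) - x\<^sup>2 / 2 - ln (real N)"
    using x N by (simp add: ln_mult ln_div ln_realpow L_def power2_eq_square)
  moreover have "real M * (L - ln 2) \<ge> x\<^sup>2 * L / 2 + 3 * x - real M * (7 / 10)"
  proof -
    have "real M * ln 2 \<le> real M * (7 / 10)" using ln2_le_25_over_36 by (intro mult_left_mono) auto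
    moreover have "x * 2 \<le> x * L" using ln x by (intro mult_left_mono) (auto simp: L_def x_def)
    moreover have "real M * L = x\<^sup>2 * L / 2 + 3 / 2 * (x * L)" unfolding M_eq by (simp add: field_simps)
    ultimately show ?thesis by (simp add: algebra_simps)
  qed
  ultimately have "x\<^sup>2 * L / 2 - x\<^sup>2 \<le> ln (1 / (real N * exp (x * (x / 2)) / (x / 2) ^ M))"
    using x M_eq by (simp add: field_simps)
  then show ?thesis by (simp add: x_def L_def)
qed

lemma norm_exp_minus_one_le:
  fixes u :: complex
  assumes "cmod u \<le> 1 / 2"
  shows "cmod (exp u - 1) \<le> 2 * cmod u"
proof -
  have "norm (exp u - (\<Sum>k\<le>0. u ^ k / fact k)) \<le> exp \<bar>Re u\<bar> * norm u ^ Suc 0 / fact 0"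
    by (rule Taylor_exp)
  moreover have "exp \<bar>Re u\<bar> \<le> 2"
    using abs_Re_le_cmod[of u] assms exp_bound_half[of "\<bar>Re u\<bar>"] by simp
  then have "exp \<bar>Re u\<bar> * cmod u \<le> 2 * cmod u" by (rule mult_right_mono) simp
  ultimately show ?thesis by simp
qed

subsection \<open>Bounds for the extremal constant\<close>

text \<open>As the product bound is independent of \<open>a\<close>, all coefficients obey one
  estimate, ready to be summed.\<close>

lemma coeff_bound_of_Kset:
  assumes \<alpha>: "0 < \<alpha>" "\<alpha> < 1" "\<alpha> \<notin> \<rat>" and n: "1 \<le> n" and q: "0 < q" "cf_qq \<alpha> k = int q" "q \<le> n"
    and Q: "cf_qq \<alpha> (Suc k) = int Q" "n < Q" and M: "card (lattice_triangle n) = Suc M"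
    and c: "supnorm n c (Kset \<alpha>) \<le> 1" and a: "a \<in> lattice_triangle n"
  shows "cmod (c (fst a) (snd a)) \<le> (real M + real n) ^ M /
    ((1 / (4 * real n)) ^ n * (1 / real Q) ^ (n div q) * (exp (- real n) ^ (n + 1) * (real n / 2) ^ (\<Sum>j\<le>n. n - j)))"
    (is "_ \<le> _ / ?D")
proof -
  have D: "0 < ?D" using n Q by (intro mult_pos_pos zero_less_power) auto
  have "2 * 3 \<le> (n + 1) * (n + 2)" using n by (intro mult_mono) auto
  then have "0 < M" using card_lattice_triangle[of n] M by linarith
  have "cmod (c (fst a) (snd a)) * ?D
      \<le> cmod (c (fst a) (snd a)) * (\<Prod>b\<in>lattice_triangle n - {a}. cmod (expo \<alpha> a - expo \<alpha> b))"
    by (intro mult_left_mono prod_expo_diff_ge[OF \<alpha>(3) n q Q a]) simp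
  also have "\<dots> \<le> (real M + real n) ^ M"
  proof (rule exp_sum_coeff_bound[OF finite_lattice_triangle a M \<open>0 < M\<close>, where c = "\<lambda>b. c (fst b) (snd b)"])
    fix z :: complex assume "cmod z \<le> 1"
    then show "cmod (\<Sum>b\<in>lattice_triangle n. c (fst b) (snd b) * exp (expo \<alpha> b * z)) \<le> 1"
      using norm_poly2_le_supnorm_Kset[OF \<alpha>(1,2), of z n c] c unfolding poly2_exp by linarith
  qed (rule cmod_expo_le[OF \<alpha>(1,2)])
  finally show ?thesis using D by (simp only: pos_le_divide_eq)
qed

text \<open>Positivity of \<open>E_n\<close> is a premise of the second part because it comes from
  \<open>E_n_ge_one\<close>, which itself rests on the boundedness in the first part.\<close>

lemma E_n_upper:
  assumes \<alpha>: "0 < \<alpha>" "\<alpha> < 1" "\<alpha> \<notin> \<rat>" and n: "1 \<le> n" and q: "0 < q" "cf_qq \<alpha> k = int q" "q \<le> n"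
    and Q: "cf_qq \<alpha> (Suc k) = int Q" "n < Q"
  shows "bdd_above {supnorm n c bidisk | c. supnorm n c (Kset \<alpha>) \<le> 1}"
    and "0 < E_n \<alpha> n \<Longrightarrow> e_n \<alpha> n \<le> real n ^ 2 * ln (real n) / 2 + 9 * real n ^ 2 + real n / real q * ln (real Q)"
proof -
  define N where "N = card (lattice_triangle n)"
  define M where "M = N - 1"
  have "(0, 0) \<in> lattice_triangle n" by (simp add: mem_lattice_triangle)
  then have "0 < N" unfolding N_def by (auto simp: card_gt_0_iff)
  then have M: "N = Suc M" by (simp add: M_def)
  define U where "U = real N * ((real M + real n) ^ M /
    ((1 / (4 * real n)) ^ n * (1 / real Q) ^ (n div q) * (exp (- real n) ^ (n + 1) * (real n / 2) ^ (\<Sum>j\<le>n. n - j))))"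
  have le_U: "supnorm n c bidisk \<le> U" if c: "supnorm n c (Kset \<alpha>) \<le> 1" for c
    unfolding supnorm_def
  proof (rule cSUP_least[OF bidisk_nonempty])
    fix p assume "p \<in> bidisk"
    then have "cmod (poly2 n c (fst p) (snd p)) \<le> (\<Sum>b\<in>lattice_triangle n. cmod (c (fst b) (snd b)))"
      by (rule norm_poly2_bidisk_le)
    also have "\<dots> \<le> U"
      unfolding U_def N_def
      by (rule sum_bounded_above) (rule coeff_bound_of_Kset[OF \<alpha> n q Q M[unfolded N_def] c])
    finally show "cmod (poly2 n c (fst p) (snd p)) \<le> U" .
  qed
  then show "bdd_above {supnorm n c bidisk | c. supnorm n c (Kset \<alpha>) \<le> 1}"
    by (auto intro!: bdd_aboveI)
  assume pos: "0 < E_n \<alpha> n"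
  \<comment> \<open>The zero polynomial is admissible, so the supremum is over a nonempty
    set.\<close>
  have "supnorm n (\<lambda>_ _. 0) (Kset \<alpha>) \<le> 1"
    unfolding supnorm_def
    by (rule cSUP_least) (auto simp: Kset_def poly2_def intro: exI[of _ 0])
  then have "E_n \<alpha> n \<le> U" unfolding E_n_def using le_U by (intro cSup_least) auto
  then have "e_n \<alpha> n \<le> ln U" unfolding e_n_def using pos by simp
  also have "ln U \<le> real n ^ 2 * ln (real n) / 2 + 9 * real n ^ 2 + real n / real q * ln (real Q)"
    unfolding U_def
    using card_lattice_triangle[of n]
    by (intro upper_exponent_le n M q(1) Q(2) sum_diff_atMost) (simp add: N_def)
  finally show "e_n \<alpha> n \<le> real n ^ 2 * ln (real n) / 2 + 9 * real n ^ 2 + real n / real q * ln (real Q)" .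
qed

text \<open>The constant polynomial 1 is admissible.\<close>

lemma E_n_ge_one:
  assumes "bdd_above {supnorm n c bidisk | c. supnorm n c (Kset \<alpha>) \<le> 1}"
  shows "1 \<le> E_n \<alpha> n"
proof -
  define c :: "nat \<Rightarrow> nat \<Rightarrow> complex" where "c = (\<lambda>i j. \<Sum>k\<in>{()}. if 0 = i \<and> 0 = j then 1 else 0)"
  have c: "poly2 n c z w = 1" for z w
    unfolding c_def by (subst poly2_monomials) auto
  have "1 / 1 \<le> E_n \<alpha> n"
  proof (rule E_n_ge[OF assms])
    show "1 \<le> supnorm n c bidisk" using norm_poly2_le_supnorm_bidisk[of 0 0 n c] by (simp add: c)
  qed (auto simp: c)
  then show ?thesis by simp
qed

text \<open>For \<open>ln n < 2\<close> the left side is negative while \<open>e_n\<close> is not.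
  Otherwise a nonzero coefficient vector with \<open>M\<close> vanishing moments gives a function
  that is small on the disc, whereas the bidisk norm is at least the average \<open>S / N\<close> of
  the coefficient moduli.\<close>

lemma e_n_ge_generic:
  assumes bdd: "bdd_above {supnorm n c bidisk | c. supnorm n c (Kset \<alpha>) \<le> 1}"
    and \<alpha>: "0 < \<alpha>" "\<alpha> < 1" and n: "1 \<le> n"
  shows "real n ^ 2 * ln (real n) / 2 - real n ^ 2 \<le> e_n \<alpha> n"
proof (cases "2 \<le> ln (real n)")
  case False
  then have "real n ^ 2 * ln (real n) \<le> real n ^ 2 * 2" by (intro mult_left_mono) auto
  moreover have "0 \<le> e_n \<alpha> n" using E_n_ge_one[OF bdd] by (simp add: e_n_def)
  ultimately show ?thesis by simp
next
  case True
  have "2 \<le> n"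
  proof (rule ccontr)
    assume "\<not> 2 \<le> n" then have "n = 1" using n by simp
    then show False using True by simp
  qed
  define N where "N = card (lattice_triangle n)"
  define M where "M = N - 1"
  have "(0, 0) \<in> lattice_triangle n" by (simp add: mem_lattice_triangle)
  then have N: "0 < N" unfolding N_def by (auto simp: card_gt_0_iff)
  then have M: "N = Suc M" by (simp add: M_def)
  have "M < card (lattice_triangle n)" using M N_def by simp
  from homogeneous_system_nontrivial_solution[OF finite_lattice_triangle this, of "\<lambda>k b. expo \<alpha> b ^ k"]
  obtain u where u: "\<exists>b\<in>lattice_triangle n. u b \<noteq> 0"
    and moments: "\<And>k. k < M \<Longrightarrow> (\<Sum>b\<in>lattice_triangle n. u b * expo \<alpha> b ^ k) = 0" by auto
  define c where "c = (\<lambda>i j. u (i, j))"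
  define S where "S = (\<Sum>b\<in>lattice_triangle n. cmod (u b))"
  have "0 < S" unfolding S_def using u by (auto intro!: sum_pos2)
  have "S \<le> real N * supnorm n c bidisk"
    unfolding S_def N_def
  proof (rule sum_bounded_above)
    fix b assume "b \<in> lattice_triangle n"
    then show "cmod (u b) \<le> supnorm n c bidisk"
      using coeff_le_supnorm_bidisk[of "fst b" "snd b" n c] by (simp add: c_def)
  qed
  then have S_le: "S / real N \<le> supnorm n c bidisk" using N by (simp add: field_simps)
  \<comment> \<open>The expression \<open>exp (n * R) / R ^ M\<close> is minimal at
    \<open>R = M / n = (n + 3) / 2\<close>; the nearby value \<open>n / 2\<close> keeps the formulas
    simple.\<close>
  define R where "R = real n / 2"
  have R: "1 \<le> R" using \<open>2 \<le> n\<close> by (simp add: R_def)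
  have "(S / real N) / (S * exp (real n * R) / R ^ M) \<le> E_n \<alpha> n"
  proof (rule E_n_ge[OF bdd _ _ S_le])
    show "0 < S * exp (real n * R) / R ^ M" using \<open>0 < S\<close> R by simp
    fix z assume z: "cmod z \<le> 1"
    have "cmod (\<Sum>b\<in>lattice_triangle n. u b * exp (expo \<alpha> b * z)) \<le> S * exp (real n * R) / R ^ M"
      unfolding S_def
      by (rule exp_sum_vanishing_moments_bound) (use moments cmod_expo_le[OF \<alpha>] R z in auto)
    then show "cmod (poly2 n c (exp z) (exp (complex_of_real \<alpha> * z))) \<le> S * exp (real n * R) / R ^ M"
      by (simp add: poly2_exp c_def)
  qed
  also have "(S / real N) / (S * exp (real n * R) / R ^ M) = 1 / (real N * exp (real n * R) / R ^ M)"
    using \<open>0 < S\<close> by simp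
  finally have "1 / (real N * exp (real n * R) / R ^ M) \<le> E_n \<alpha> n" .
  moreover have "0 < 1 / (real N * exp (real n * R) / R ^ M)" using N R by simp
  ultimately have "ln (1 / (real N * exp (real n * R) / R ^ M)) \<le> e_n \<alpha> n"
    unfolding e_n_def by (subst ln_le_cancel_iff) auto
  moreover have "real n ^ 2 * ln (real n) / 2 - real n ^ 2 \<le> ln (1 / (real N * exp (real n * R) / R ^ M))"
    unfolding R_def using card_lattice_triangle[of n]
    by (intro lower_exponent_ge True n M) (simp add: N_def)
  ultimately show ?thesis by linarith
qed

text \<open>At parameter \<open>z\<close> of the curve the difference of the two powers is
  \<open>exp (p * z) * (1 - exp (\<theta> * z))\<close> with
  \<open>\<bar>\<theta>\<bar> \<le> 1 / Q\<close>, while at a suitable point \<open>(1, w)\<close>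
  of the bidisk it is 2. The exponent \<open>m = n div q\<close> is the largest that keeps the
  degree at most \<open>n\<close>.\<close>

lemma e_n_ge_diophantine:
  assumes bdd: "bdd_above {supnorm n c bidisk | c. supnorm n c (Kset \<alpha>) \<le> 1}"
    and \<alpha>: "0 < \<alpha>" "\<alpha> < 1" and q: "0 < q" "q \<le> n" and "2 \<le> Q" and p: "p \<le> q"
    and approx: "\<bar>real q * \<alpha> - real p\<bar> \<le> 1 / Q"
  shows "real (n div q) * ln Q - real n \<le> e_n \<alpha> n"
proof -
  define m where "m = n div q"
  define \<theta> where "\<theta> = real q * \<alpha> - real p"
  define c where "c = (\<lambda>i j. \<Sum>k\<le>m. if p * k = i \<and> q * (m - k) = j then of_nat (m choose k) * (-1 :: complex) ^ (m - k) else 0)"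
  have qm: "q * m \<le> n" unfolding m_def by simp
  have poly: "poly2 n c z w = (z ^ p - w ^ q) ^ m" for z w
  proof -
    have deg: "p * k + q * (m - k) \<le> n" if "k \<le> m" for k
    proof -
      have "p * k + q * (m - k) \<le> q * k + q * (m - k)" using p by simp
      also have "\<dots> = q * m" using that by (simp flip: add_mult_distrib2)
      finally show ?thesis using qm by simp
    qed
    have "poly2 n c z w = (\<Sum>k\<le>m. of_nat (m choose k) * (-1) ^ (m - k) * z ^ (p * k) * w ^ (q * (m - k)))"
      unfolding c_def by (rule poly2_monomials) (use deg in auto)
    also have "\<dots> = (\<Sum>k\<le>m. of_nat (m choose k) * (z ^ p) ^ k * (- (w ^ q)) ^ (m - k))"
      by (intro sum.cong refl) (simp add: power_mult power_minus[of "w ^ q"])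
    also have "\<dots> = (z ^ p - w ^ q) ^ m"
      using binomial_ring[of "z ^ p" "- (w ^ q)" m] by simp
    finally show ?thesis .
  qed
  define B where "B = (exp (real p) * (2 / Q)) ^ m"
  have "0 < B" unfolding B_def using \<open>2 \<le> Q\<close> by simp
  have "2 ^ m / B \<le> E_n \<alpha> n"
  proof (rule E_n_ge[OF bdd \<open>0 < B\<close>])
    \<comment> \<open>A solution of \<open>w ^ q = -1\<close> on the unit circle, so that
      \<open>1 - w ^ q\<close> attains the value 2.\<close>
    define w where "w = exp (complex_of_real (pi / real q) * \<i>)"
    have "of_nat q * (complex_of_real (pi / real q) * \<i>) = complex_of_real pi * \<i>"
      using q by simp
    then have "w ^ q = -1"
      unfolding w_def exp_of_nat_mult[symmetric] by (simp only: exp_pi_i)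
    then have "cmod (poly2 n c 1 w) = 2 ^ m" unfolding poly by (simp add: norm_power)
    moreover have "cmod w = 1" unfolding w_def by (simp add: norm_exp_eq_Re)
    ultimately show "2 ^ m \<le> supnorm n c bidisk"
      using norm_poly2_le_supnorm_bidisk[of 1 w n c] by simp
  next
    fix z assume z: "cmod z \<le> 1"
    have "exp (of_real \<alpha> * z) ^ q = exp (of_nat p * z) * exp (of_real \<theta> * z)"
      by (simp add: \<theta>_def algebra_simps flip: exp_add exp_of_nat_mult)
    then have "exp z ^ p - exp (of_real \<alpha> * z) ^ q = - (exp (of_nat p * z) * (exp (of_real \<theta> * z) - 1))"
      using exp_of_nat_mult[of p z] by (simp add: algebra_simps)
    then have eq: "cmod (exp z ^ p - exp (of_real \<alpha> * z) ^ q) = cmod (exp (of_nat p * z)) * cmod (exp (of_real \<theta> * z) - 1)"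
      by (simp add: norm_mult)
    have "cmod (of_nat p * z) \<le> real p * 1" unfolding norm_mult using z by (intro mult_mono) auto
    then have 1: "cmod (exp (of_nat p * z)) \<le> exp (real p)"
      by (intro order_trans[OF norm_exp]) simp
    have "cmod (of_real \<theta> * z) \<le> 1 / Q * 1"
      unfolding norm_mult norm_of_real using z approx[folded \<theta>_def] \<open>2 \<le> Q\<close>
      by (intro mult_mono) auto
    moreover have "1 / Q \<le> 1 / 2" using \<open>2 \<le> Q\<close> by simp
    ultimately have "cmod (exp (of_real \<theta> * z) - 1) \<le> 2 / Q"
      using norm_exp_minus_one_le[of "of_real \<theta> * z"] by (simp add: field_simps)
    then have "cmod (exp z ^ p - exp (of_real \<alpha> * z) ^ q) \<le> exp (real p) * (2 / Q)"
      unfolding eq using 1 by (intro mult_mono) auto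
    then show "cmod (poly2 n c (exp z) (exp (of_real \<alpha> * z))) \<le> B"
      unfolding poly norm_power B_def by (intro power_mono) auto
  qed
  \<comment> \<open>The 2 gained at \<open>(1, w)\<close> cancels the 2 in the bound for
    \<open>exp u - 1\<close>.\<close>
  moreover have "2 ^ m / B = (Q / exp (real p)) ^ m"
    unfolding B_def using \<open>2 \<le> Q\<close> by (simp add: power_divide power_mult_distrib)
  moreover have "0 < (Q / exp (real p)) ^ m" using \<open>2 \<le> Q\<close> by simp
  ultimately have "ln ((Q / exp (real p)) ^ m) \<le> e_n \<alpha> n"
    unfolding e_n_def by (subst ln_le_cancel_iff) auto
  moreover have "ln ((Q / exp (real p)) ^ m) = real m * (ln Q - real p)"
    using \<open>2 \<le> Q\<close> by (simp add: ln_realpow ln_div)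
  \<comment> \<open>Since \<open>p \<le> q\<close>, the loss \<open>m * p\<close> is at most
    \<open>m * q\<close>, hence at most \<open>n\<close>.\<close>
  moreover have "real (m * p) \<le> real n"
    using order_trans[OF mult_le_mono2[OF p, of m]] qm by (intro of_nat_mono) (auto simp: mult.commute)
  ultimately show ?thesis by (simp add: m_def algebra_simps)
qed

theorem theorem1:
  fixes \<alpha> :: real and n s :: nat
  assumes "0 < \<alpha>" "\<alpha> < 1" "\<alpha> \<notin> \<rat>"
    and "n \<ge> 1"
    and "cf_den \<alpha> s \<le> int n" "int n < cf_den \<alpha> (Suc s)"
  shows "max (real n ^ 2 * ln (real n) / 2 - real n ^ 2)
             (real_of_int \<lfloor>real n / real_of_int (cf_den \<alpha> s)\<rfloor> * ln (real_of_int (cf_den \<alpha> (Suc s))) - real n)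
           \<le> e_n \<alpha> n
       \<and> e_n \<alpha> n \<le> real n ^ 2 * ln (real n) / 2 + 9 * real n ^ 2
             + real n / real_of_int (cf_den \<alpha> s) * ln (real_of_int (cf_den \<alpha> (Suc s)))"
proof -
  define q Q where "q = nat (cf_den \<alpha> s)" and "Q = nat (cf_den \<alpha> (Suc s))"
  have pos: "1 \<le> cf_den \<alpha> s" "1 \<le> cf_den \<alpha> (Suc s)"
    using cf_qq_pos[OF assms(3)] by (auto simp: cf_den_def simp del: cf_qq.simps)
  have den: "cf_den \<alpha> s = int q" "cf_den \<alpha> (Suc s) = int Q" using pos by (auto simp: q_def Q_def)
  \<comment> \<open>The denominator \<open>q_s\<close> is \<open>cf_qq\<close> at
    \<open>Suc s\<close>, so the lemmas above are applied with \<open>k = Suc s\<close>.\<close>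
  have q: "0 < q" "cf_qq \<alpha> (Suc s) = int q" "q \<le> n"
    and Q: "cf_qq \<alpha> (Suc (Suc s)) = int Q" "n < Q"
    using pos assms(5,6) den by (auto simp: cf_den_def simp del: cf_qq.simps)
  note upper = E_n_upper[OF assms(1-4) q Q]
  \<comment> \<open>An error of at most 1/2 together with \<open>0 < q * \<alpha> < q\<close> forces
    the integer numerator to lie between 0 and \<open>q\<close>, so it can serve as the exponent
    \<open>p\<close>.\<close>
  have "\<bar>real q * \<alpha> - cf_pp \<alpha> (Suc s)\<bar> \<le> 1 / real Q"
    using cf_err_le[OF assms(3), of "Suc s"] unfolding cf_err_def q Q by simp
  moreover have "1 / real Q \<le> 1 / 2" using Q(2) assms(4) by simp
  moreover have "0 < real q * \<alpha>" "real q * \<alpha> < real q" using q(1) assms by auto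
  ultimately have "-1 < real_of_int (cf_pp \<alpha> (Suc s))" "real_of_int (cf_pp \<alpha> (Suc s)) < real_of_int (int q + 1)"
    and approx: "\<bar>real q * \<alpha> - cf_pp \<alpha> (Suc s)\<bar> \<le> 1 / real Q" by auto
  then have "0 \<le> cf_pp \<alpha> (Suc s)" "cf_pp \<alpha> (Suc s) \<le> int q" by linarith+
  then obtain p where p: "cf_pp \<alpha> (Suc s) = int p" "p \<le> q" by (metis nonneg_int_cases of_nat_le_iff)
  have "real (n div q) * ln (real Q) - real n \<le> e_n \<alpha> n"
    by (rule e_n_ge_diophantine[OF upper(1) assms(1,2) q(1,3) _ p(2)])
      (use approx Q(2) assms(4) p(1) in auto)
  moreover have "\<lfloor>real n / real q\<rfloor> = int (n div q)" by (rule floor_divide_of_nat_eq)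
  moreover have "0 < E_n \<alpha> n" using E_n_ge_one[OF upper(1)] by linarith
  ultimately show ?thesis
    using e_n_ge_generic[OF upper(1) assms(1,2,4)] upper(2) by (simp add: den)
qed

end
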